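(* Consider the Nicholson equation $$x'(t)=\beta(t)\Big(\sum_{j=1}^m p_j\,x(t-\tau_j(t))\,e^{-a_j x(t-\sigma_j(t))}-\delta x(t)\Big),\qquad t\ge t_0,$$ where $m\ge 1$, $p_j,a_j,\delta\in(0,\infty)$, and $\beta,\sigma_j,\tau_j:[t_0,\infty)\to[0,\infty)$ are continuous and bounded ($1\le j\le m$) with $0<\beta^-:=\inf_{t\ge t_0}\beta(t)\le\beta^+:=\sup_{t\ge t_0}\beta(t)<\infty$. Let $p=\sum_{j=1}^m p_j$ and assume $p>\delta$. Let $K>0$ be the unique positive equilibrium, i.e. the unique positive solution of $\sum_{j=1}^m p_je^{-a_jK}=\delta$, and let $\tau=\max\{\sup_{t\ge t_0}\tau_j(t),\ \sup_{t\ge t_0}\sigma_j(t): 1\le j\le m\}$. Then the equation is permanent. Moreover, for every solution $x(t)$ with initial condition in $C_0^+$, $$Ke^{-2\delta\beta^+\tau}\le\liminf_{t\to\infty}x(t)\le\limsup_{t\to\infty}x(t)\le Ke^{2(\delta+p)\beta^+\tau}.$$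
   Context: The phase space is $C=C([-\tau,0];\mathbb{R})$ with the supremum norm. The set of admissible initial conditions is $C_0^+=\{\phi\in C:\phi(\theta)\ge 0 \text{ for }\theta\in[-\tau,0),\ \phi(0)>0\}$. For $\phi\in C_0^+$, $x(t;t_0,\phi)$ denotes the solution of the equation with $x(t_0+\theta)=\phi(\theta)$ for $\theta\in[-\tau,0]$; such solutions are defined and positive on $[t_0,\infty)$. The equation is called permanent if there are constants $c_1,c_2>0$ such that for every $\phi\in C_0^+$ there is $t_*=t_*(\phi)$ with $c_1\le x(t;t_0,\phi)\le c_2$ for all $t\ge t_*$. *)

theory Defs
  imports "HOL-Analysis.Analysis"
begin

definition max_delay ::
  "real \<Rightarrow> nat \<Rightarrow> (nat \<Rightarrow> real \<Rightarrow> real) \<Rightarrow> (nat \<Rightarrow> real \<Rightarrow> real) \<Rightarrow> real" where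
  "max_delay t0 m \<tau> \<sigma> =
     Max ((\<lambda>j. SUP t\<in>{t0..}. \<tau> j t) ` {1..m} \<union> (\<lambda>j. SUP t\<in>{t0..}. \<sigma> j t) ` {1..m})"

text \<open>
  Elements of the phase space \<open>C([-r,0])\<close> are represented by total functions, of which only
  the values on \<open>[-r,0]\<close> matter.
\<close>

definition admissible_histories :: "real \<Rightarrow> (real \<Rightarrow> real) set" where
  "admissible_histories r =
     {\<phi>. continuous_on {-r..0} \<phi> \<and> (\<forall>\<theta>\<in>{-r..<0}. 0 \<le> \<phi> \<theta>) \<and> 0 < \<phi> 0}"

text \<open>
  \<open>x\<close> is a solution on \<open>[t0,\<infinity>)\<close> with initial function \<open>\<phi>\<close>; at \<open>t0\<close> the derivative is the
  right-hand one. Only the values of \<open>x\<close> on \<open>[t0 - r,\<infinity>)\<close>, \<open>r\<close> being the maximal delay, matter.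
\<close>

definition nicholson_solution ::
  "real \<Rightarrow> nat \<Rightarrow> (nat \<Rightarrow> real) \<Rightarrow> (nat \<Rightarrow> real) \<Rightarrow> real \<Rightarrow> (real \<Rightarrow> real) \<Rightarrow>
   (nat \<Rightarrow> real \<Rightarrow> real) \<Rightarrow> (nat \<Rightarrow> real \<Rightarrow> real) \<Rightarrow> (real \<Rightarrow> real) \<Rightarrow> (real \<Rightarrow> real) \<Rightarrow> bool" where
  "nicholson_solution t0 m p a \<delta> \<beta> \<tau> \<sigma> \<phi> x \<longleftrightarrow>
     (\<forall>\<theta>\<in>{- max_delay t0 m \<tau> \<sigma>..0}. x (t0 + \<theta>) = \<phi> \<theta>) \<and>
     (\<forall>t\<ge>t0. (x has_real_derivative
        \<beta> t * ((\<Sum>j=1..m. p j * x (t - \<tau> j t) * exp (- a j * x (t - \<sigma> j t))) - \<delta> * x t))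
        (at t within {t0..}))"

definition nicholson_permanent ::
  "real \<Rightarrow> nat \<Rightarrow> (nat \<Rightarrow> real) \<Rightarrow> (nat \<Rightarrow> real) \<Rightarrow> real \<Rightarrow> (real \<Rightarrow> real) \<Rightarrow>
   (nat \<Rightarrow> real \<Rightarrow> real) \<Rightarrow> (nat \<Rightarrow> real \<Rightarrow> real) \<Rightarrow> bool" where
  "nicholson_permanent t0 m p a \<delta> \<beta> \<tau> \<sigma> \<longleftrightarrow>
     (\<exists>c1>0. \<exists>c2>0. \<forall>\<phi>\<in>admissible_histories (max_delay t0 m \<tau> \<sigma>).
        \<forall>x. nicholson_solution t0 m p a \<delta> \<beta> \<tau> \<sigma> \<phi> x \<longrightarrow>
          (\<exists>t1\<ge>t0. \<forall>t\<ge>t1. c1 \<le> x t \<and> x t \<le> c2))"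

definition positive_equilibrium ::
  "nat \<Rightarrow> (nat \<Rightarrow> real) \<Rightarrow> (nat \<Rightarrow> real) \<Rightarrow> real \<Rightarrow> real" where
  "positive_equilibrium m p a \<delta> = (THE K. 0 < K \<and> (\<Sum>j=1..m. p j * exp (- a j * K)) = \<delta>)"

lemma positive_equilibrium_unique:
  fixes p a :: "nat \<Rightarrow> real"
  assumes "\<And>j. j \<in> {1..m} \<Longrightarrow> 0 < p j" "\<And>j. j \<in> {1..m} \<Longrightarrow> 0 < a j"
    and "0 < \<delta>" "\<delta> < (\<Sum>j=1..m. p j)"
  shows "\<exists>!K. 0 < K \<and> (\<Sum>j=1..m. p j * exp (- a j * K)) = \<delta>"
proof -
  define h where "h = (\<lambda>K::real. \<Sum>j=1..m. p j * exp (- a j * K))"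
  have ne: "{1..m} \<noteq> {}" using assms(3,4) by (metis less_trans less_irrefl sum.empty)
  have anti: "h y < h x" if "x < y" for x y
    unfolding h_def using assms(1,2) that ne by (intro sum_strict_mono) auto
  have "(h \<longlongrightarrow> (\<Sum>j=1..m. p j * 0)) at_top"
    unfolding h_def
  proof (intro tendsto_sum tendsto_mult tendsto_const)
    fix j assume j: "j \<in> {1..m}"
    have "filterlim (\<lambda>K. a j * K) at_top at_top"
      using assms(2)[OF j]
      by (intro filterlim_tendsto_pos_mult_at_top[OF tendsto_const _ filterlim_ident])
    then have "filterlim (\<lambda>K. - (a j * K)) at_bot at_top"
      by (simp add: filterlim_uminus_at_top)
    then show "((\<lambda>K. exp (- a j * K)) \<longlongrightarrow> 0) at_top"
      using filterlim_compose[OF exp_at_bot] by simp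
  qed
  then have "eventually (\<lambda>K. h K < \<delta> \<and> 0 < K) at_top"
    using assms(3) by (intro eventually_conj order_tendstoD(2) eventually_gt_at_top) auto
  then obtain b where b: "h b < \<delta>" "0 < b"
    by (auto dest: eventually_happens simp: trivial_limit_at_top_linorder)
  have h0: "\<delta> < h 0" using assms(4) by (simp add: h_def)
  have "continuous_on {0..b} h" unfolding h_def by (intro continuous_intros)
  then obtain K where K: "0 \<le> K" "h K = \<delta>"
    using IVT2'[of h b \<delta> 0] b h0 by auto
  then have "0 < K" using h0 by (cases "K = 0") auto
  moreover have "y = K" if "h y = \<delta>" for y
    using anti[of y K] anti[of K y] that K(2) by (cases y K rule: linorder_cases) auto
  ultimately show ?thesis using K(2) unfolding h_def by blast
qed

end

theory Submission
  imports Defs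
begin

text \<open>
  Razumikhin argument for \<open>ln x\<close> and \<open>- ln x\<close>. At a time \<open>t\<close> where \<open>x\<close> almost dominates its
  past over one delay, \<open>x'(t) / x(t)\<close> is at most about
  \<open>\<beta>(t) (\<Sum>j. p\<^sub>j exp(- a\<^sub>j x(t - \<sigma>\<^sub>j)) - \<delta>)\<close>, which is negative unless \<open>x\<close> drops to about
  \<open>K\<close> within the last delay. But from such a drop \<open>x\<close> grows at most by the factor
  \<open>exp((\<delta> + p) \<beta>\<^sup>+ \<tau>)\<close> within one delay, so large values of \<open>x\<close> must decay. Symmetrically, where
  \<open>x\<close> is almost minimal over its past, it increases unless it was about \<open>K\<close> within the
  last delay, from where it cannot lose more than the factor \<open>exp(- \<delta> \<beta>\<^sup>+ \<tau>)\<close>. Both exponents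
  are half of the claimed ones.
\<close>

section \<open>Comparison tools and the Razumikhin criterion for real functions\<close>

text \<open>A function that starts below zero cannot have a negative derivative at its first zero,
  since it would be positive just before. In \<open>cross\<close> the values at all earlier times
  may be taken negative; this controls the delayed terms when \<open>f\<close> compares a solution
  with a barrier.\<close>

lemma first_crossing:
  fixes f f' :: "real \<Rightarrow> real"
  assumes cont: "continuous_on {a..} f"
    and deriv: "\<And>t. a < t \<Longrightarrow> (f has_real_derivative f' t) (at t)"
    and start: "f a < 0"
    and cross: "\<And>u. a < u \<Longrightarrow> f u = 0 \<Longrightarrow> (\<And>s. a \<le> s \<Longrightarrow> s < u \<Longrightarrow> f s < 0) \<Longrightarrow> f' u < 0"
    and "a \<le> t"
  shows "f t < 0"
proof (rule ccontr)
  assume "\<not> f t < 0"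
  define S where "S = {s \<in> {a..t}. 0 \<le> f s}"
  define u where "u = Inf S"
  have "t \<in> S" using \<open>\<not> f t < 0\<close> \<open>a \<le> t\<close> by (simp add: S_def)
  have bdd: "bdd_below S" unfolding S_def by (rule bdd_belowI[of _ a]) auto
  have contt: "continuous_on {a..t} f" by (rule continuous_on_subset[OF cont]) auto
  then have "closed S" unfolding S_def
    using closed_Collect_le continuous_closed_preimage[OF contt _ closed_atLeast[of 0]]
    by (auto simp: vimage_def Int_def)
  then have "u \<in> S" unfolding u_def using closed_contains_Inf[OF _ bdd] \<open>t \<in> S\<close> by blast
  then have u: "a \<le> u" "u \<le> t" "0 \<le> f u" by (auto simp: S_def)
  have before: "f s < 0" if "a \<le> s" "s < u" for s
    using cInf_lower[OF _ bdd, of s] that u unfolding S_def u_def by force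
  have "a < u" using u start by (cases "a = u") auto
  have "f u \<le> 0"
  proof (rule ccontr)
    assume "\<not> f u \<le> 0"
    then obtain v where "a \<le> v" "v \<le> u" "f v = 0"
      using IVT'[of f a 0 u] start u(1) continuous_on_subset[OF contt, of "{a..u}"] u(2) by auto
    then show False using before[of v] \<open>\<not> f u \<le> 0\<close> by (cases "v = u") auto
  qed
  with u have "f u = 0" by simp
  then have "f' u < 0" using cross \<open>a < u\<close> before by blast
  from DERIV_neg_dec_left[OF deriv[OF \<open>a < u\<close>] this]
  obtain d where d: "d > 0" "\<And>h. 0 < h \<Longrightarrow> h < d \<Longrightarrow> f u < f (u - h)" by blast
  define h where "h = min (d / 2) (u - a)"
  have "0 < h" "h < d" "a \<le> u - h" using d \<open>a < u\<close> by (auto simp: h_def min_def)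
  then show False using d(2)[of h] before[of "u - h"] \<open>f u = 0\<close> by auto
qed

text \<open>Above level \<open>\<mu>\<close> the function falls at rate at least
  \<open>\<kappa>\<close>, so it reaches \<open>\<mu>\<close> in finite time. It cannot leave again,
  as an excursion above \<open>\<mu>\<close> would have to begin with growth above
  \<open>\<mu>\<close>.\<close>

lemma eventually_le_of_decrease_above:
  fixes y D :: "real \<Rightarrow> real"
  assumes deriv: "\<And>t. T \<le> t \<Longrightarrow> (y has_real_derivative D t) (at t)"
    and "0 < \<kappa>"
    and dec: "\<And>t. T \<le> t \<Longrightarrow> \<mu> \<le> y t \<Longrightarrow> D t \<le> - \<kappa>"
  shows "\<forall>\<^sub>F t in at_top. y t \<le> \<mu>"
proof -
  have "\<exists>t\<ge>T. y t \<le> \<mu>"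
  proof (rule ccontr)
    assume "\<not> ?thesis"
    then have above: "\<mu> < y t" if "T \<le> t" for t using that by force
    \<comment> \<open>The time by which a descent from \<open>y T\<close> at rate
      \<open>\<kappa>\<close> has reached \<open>\<mu>\<close>.\<close>
    define t where "t = T + (y T - \<mu>) / \<kappa>"
    have "T < t" using above[of T] \<open>0 < \<kappa>\<close> by (simp add: t_def)
    from MVT2[OF this, of y D] obtain z where z: "T < z" "y t - y T = (t - T) * D z"
      using deriv by auto
    have "(t - T) * D z \<le> (t - T) * (- \<kappa>)"
      using dec[of z] above[of z] z \<open>T < t\<close> by (intro mult_left_mono) auto
    also have "\<dots> = \<mu> - y T" using \<open>0 < \<kappa>\<close> by (simp add: t_def)
    finally show False using z above[of t] \<open>T < t\<close> by simp
  qed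
  then obtain b where b: "T \<le> b" "y b \<le> \<mu>" by blast
  have cont: "isCont y s" if "T \<le> s" for s using deriv[OF that] DERIV_isCont by blast
  have "y t \<le> \<mu>" if "b \<le> t" for t
  proof (rule ccontr)
    assume "\<not> y t \<le> \<mu>"
    have conti: "continuous_on {b..t} y"
      using cont b by (intro continuous_at_imp_continuous_on) auto
    define S where "S = {s \<in> {b..t}. y s \<le> \<mu>}"
    have "b \<in> S" using b that by (simp add: S_def)
    have bdd: "bdd_above S" unfolding S_def by (rule bdd_aboveI[of _ t]) auto
    have "closed S" unfolding S_def
      using continuous_closed_preimage[OF conti _ closed_atMost[of \<mu>]]
      by (auto simp: vimage_def Int_def)
    \<comment> \<open>\<open>Sup S\<close> is the last time up to \<open>t\<close> with value at
      most \<open>\<mu>\<close>. Afterwards \<open>y\<close> is above \<open>\<mu>\<close>, yet the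
      mean value theorem makes it fall somewhere between \<open>Sup S\<close> and \<open>t\<close>
      although it rises overall.\<close>
    then have "Sup S \<in> S" using closed_contains_Sup[OF _ bdd] \<open>b \<in> S\<close> by blast
    then have c: "b \<le> Sup S" "Sup S \<le> t" "y (Sup S) \<le> \<mu>" by (auto simp: S_def)
    have "Sup S < t" using c \<open>\<not> y t \<le> \<mu>\<close> by (cases "Sup S = t") auto
    from MVT2[OF this, of y D] obtain z
      where z: "Sup S < z" "z < t" "y t - y (Sup S) = (t - Sup S) * D z"
      using deriv b c by (meson order_trans)
    have "\<mu> < y z"
      using cSup_upper[OF _ bdd, of z] z c unfolding S_def by force
    then have "D z < 0" using dec[of z] \<open>0 < \<kappa>\<close> b c z by fastforce
    then have "(t - Sup S) * D z < 0" using \<open>Sup S < t\<close> by (simp add: mult_pos_neg)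
    then show False using z c \<open>\<not> y t \<le> \<mu>\<close> by simp
  qed
  then show ?thesis unfolding eventually_at_top_linorder by blast
qed

text \<open>
  A Razumikhin criterion: only at times where \<open>y\<close> almost dominates its recent past is
  decay required.
\<close>

lemma razumikhin_eventually_less:
  fixes y D :: "real \<Rightarrow> real"
  assumes deriv: "\<And>t. a \<le> t \<Longrightarrow> (y has_real_derivative D t) (at t)"
    and "0 \<le> r"
    and raz: "\<And>l. C < l \<Longrightarrow> \<exists>\<epsilon>>0. \<exists>\<kappa>>0. \<forall>t\<ge>a + r.
      l - \<epsilon> \<le> y t \<longrightarrow> (\<forall>s\<in>{t - r..t}. y s \<le> l + \<epsilon>) \<longrightarrow> D t \<le> - \<kappa>"
    and "C < c"
  shows "\<forall>\<^sub>F t in at_top. y t < c"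
proof -
  have cont: "continuous_on A y" if "A \<subseteq> {a..}" for A
    using that deriv by (intro continuous_at_imp_continuous_on) (auto intro: DERIV_isCont)
  obtain M0 where M0: "y s \<le> M0" if "s \<in> {a..a + r}" for s
    using continuous_attains_sup[of "{a..a + r}" y] cont[of "{a..a + r}"] \<open>0 \<le> r\<close> by fastforce
  \<comment> \<open>\<open>M\<close> lies above the initial segment and above \<open>C\<close>, so
    \<open>raz\<close> applies at level \<open>M\<close> and prevents a first contact with
    it.\<close>
  define M where "M = max M0 C + 1"
  have "C < M" by (simp add: M_def)
  have start: "y s < M" if "s \<in> {a..a + r}" for s using M0[OF that] by (simp add: M_def)
  have bounded: "y t < M" if "a + r \<le> t" for t
  proof -
    have "y t - M < 0"
    proof (rule first_crossing[of "a + r" "\<lambda>t. y t - M" D])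
      show "continuous_on {a + r..} (\<lambda>t. y t - M)"
        using cont[of "{a + r..}"] \<open>0 \<le> r\<close> by (intro continuous_intros) auto
      show "((\<lambda>t. y t - M) has_real_derivative D t) (at t)" if "a + r < t" for t
        using deriv[of t] that \<open>0 \<le> r\<close> by (auto intro!: derivative_eq_intros)
      show "y (a + r) - M < 0" using start[of "a + r"] \<open>0 \<le> r\<close> by simp
      fix u assume u: "a + r < u" "y u - M = 0"
        and less: "\<And>s. a + r \<le> s \<Longrightarrow> s < u \<Longrightarrow> y s - M < 0"
      obtain \<epsilon> \<kappa> where e: "\<epsilon> > 0" "\<kappa> > 0" and imp: "\<forall>t\<ge>a + r.
          M - \<epsilon> \<le> y t \<longrightarrow> (\<forall>s\<in>{t - r..t}. y s \<le> M + \<epsilon>) \<longrightarrow> D t \<le> - \<kappa>"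
        using raz[OF \<open>C < M\<close>] by blast
      have "y s \<le> M + \<epsilon>" if "s \<in> {u - r..u}" for s
      proof (cases "s < a + r")
        case True then show ?thesis using start[of s] that u e by auto
      next
        case False then show ?thesis using less[of s] that u e by (cases "s = u") auto
      qed
      then have "D u \<le> - \<kappa>" using imp u e by auto
      then show "D u < 0" using e by simp
    qed fact
    then show ?thesis by simp
  qed
  \<comment> \<open>Eventual upper bounds of \<open>y\<close>, cut off at \<open>C\<close> so that
    the infimum exists even if \<open>y\<close> tends to minus infinity. The aim is
    \<open>l = C\<close>.\<close>
  define A where "A = {l. C \<le> l \<and> (\<forall>\<^sub>F t in at_top. y t \<le> l)}"
  define l where "l = Inf A"
  have "M \<in> A" using bounded \<open>C < M\<close> unfolding A_def eventually_at_top_linorder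
    by (auto intro!: exI[of _ "a + r"] less_imp_le)
  have bdd: "bdd_below A" unfolding A_def by (rule bdd_belowI[of _ C]) auto
  have "C \<le> l" unfolding l_def using \<open>M \<in> A\<close> by (intro cInf_greatest) (auto simp: A_def)
  have "l \<le> C"
  proof (rule ccontr)
    assume "\<not> l \<le> C"
    then have "C < l" by simp
    then obtain \<epsilon> \<kappa> where e: "\<epsilon> > 0" "\<kappa> > 0" and imp: "\<forall>t\<ge>a + r.
        l - \<epsilon> \<le> y t \<longrightarrow> (\<forall>s\<in>{t - r..t}. y s \<le> l + \<epsilon>) \<longrightarrow> D t \<le> - \<kappa>"
      using raz by blast
    obtain k where "k \<in> A" "k < l + \<epsilon>"
      using cInf_lessD[of A "l + \<epsilon>"] \<open>M \<in> A\<close> e unfolding l_def by auto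
    then obtain T where T: "\<And>t. T \<le> t \<Longrightarrow> y t \<le> l + \<epsilon>"
      unfolding A_def eventually_at_top_linorder by fastforce
    \<comment> \<open>One delay after \<open>T\<close> the whole window lies where \<open>y\<close>
      is at most \<open>l + \<epsilon>\<close>, so \<open>y\<close> decreases wherever it is at
      least \<open>l - \<epsilon>\<close>. The bound obtained lies in \<open>A\<close> but below its
      infimum.\<close>
    have "\<forall>\<^sub>F t in at_top. y t \<le> max C (l - \<epsilon>)"
    proof (rule eventually_le_of_decrease_above[of "max (T + r) (a + r)" y D \<kappa>])
      fix t assume t: "max (T + r) (a + r) \<le> t"
      then show "(y has_real_derivative D t) (at t)" using deriv[of t] \<open>0 \<le> r\<close> by simp
      assume "max C (l - \<epsilon>) \<le> y t"
      then show "D t \<le> - \<kappa>" using imp T t by auto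
    qed fact
    then have "max C (l - \<epsilon>) \<in> A" by (simp add: A_def)
    then have "l \<le> max C (l - \<epsilon>)" unfolding l_def by (rule cInf_lower[OF _ bdd])
    then show False using e \<open>C < l\<close> by simp
  qed
  then have "l < c" using \<open>C < c\<close> by simp
  then obtain k where "k \<in> A" "k < c" using cInf_lessD[of A c] \<open>M \<in> A\<close> unfolding l_def by auto
  then show ?thesis unfolding A_def by (auto elim: eventually_mono)
qed

section \<open>The equation along a fixed solution, and positivity\<close>

text \<open>The constants \<open>b\<close>, \<open>B\<close> and \<open>r\<close> are arbitrary
  bounds for the coefficient and the delays, which keeps infima and suprema out of the estimates.
  Likewise \<open>K\<close> enters through its positivity and its equation instead of a definite
  description.\<close>

locale nicholson =
  fixes t0 r \<delta> b B :: real and m :: nat and p a :: "nat \<Rightarrow> real" and \<beta> :: "real \<Rightarrow> real"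
    and \<tau> \<sigma> :: "nat \<Rightarrow> real \<Rightarrow> real" and x :: "real \<Rightarrow> real" and K :: real
  assumes m: "1 \<le> m"
    and p_pos: "\<And>j. j \<in> {1..m} \<Longrightarrow> 0 < p j"
    and a_pos: "\<And>j. j \<in> {1..m} \<Longrightarrow> 0 < a j"
    and \<delta>_pos: "0 < \<delta>"
    and b_pos: "0 < b"
    and \<beta>: "\<And>t. t0 \<le> t \<Longrightarrow> b \<le> \<beta> t" "\<And>t. t0 \<le> t \<Longrightarrow> \<beta> t \<le> B"
    and \<tau>: "\<And>j t. j \<in> {1..m} \<Longrightarrow> t0 \<le> t \<Longrightarrow> 0 \<le> \<tau> j t"
           "\<And>j t. j \<in> {1..m} \<Longrightarrow> t0 \<le> t \<Longrightarrow> \<tau> j t \<le> r"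
    and \<sigma>: "\<And>j t. j \<in> {1..m} \<Longrightarrow> t0 \<le> t \<Longrightarrow> 0 \<le> \<sigma> j t"
           "\<And>j t. j \<in> {1..m} \<Longrightarrow> t0 \<le> t \<Longrightarrow> \<sigma> j t \<le> r"
    and init_nonneg: "\<And>t. t0 - r \<le> t \<Longrightarrow> t < t0 \<Longrightarrow> 0 \<le> x t"
    and init_pos: "0 < x t0"
    and sol: "\<And>t. t0 \<le> t \<Longrightarrow> (x has_real_derivative
        \<beta> t * ((\<Sum>j=1..m. p j * x (t - \<tau> j t) * exp (- a j * x (t - \<sigma> j t))) - \<delta> * x t))
        (at t within {t0..})"
    and K_pos: "0 < K"
    and K_eq: "(\<Sum>j=1..m. p j * exp (- a j * K)) = \<delta>"
begin

definition P where "P = (\<Sum>j=1..m. p j)"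

definition F where
  "F t = (\<Sum>j=1..m. p j * x (t - \<tau> j t) * exp (- a j * x (t - \<sigma> j t)))"

text \<open>The per capita birth rate at constant population size \<open>z\<close>. It is strictly
  decreasing with value \<open>\<delta>\<close> at \<open>K\<close>, so \<open>K\<close> separates
  growth from decline.\<close>

definition h where "h z = (\<Sum>j=1..m. p j * exp (- a j * z))"

lemma r_nonneg: "0 \<le> r"
  using \<tau>[of 1 t0] m by auto

lemma P_pos: "0 < P"
  unfolding P_def using m p_pos by (intro sum_pos) auto

lemma B_pos: "0 < B"
  using b_pos \<beta>[of t0] by simp

lemma \<beta>_pos: "t0 \<le> t \<Longrightarrow> 0 < \<beta> t"
  using b_pos \<beta>(1)[of t] by simp

lemma h_strict_anti: "y < z \<Longrightarrow> h z < h y"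
  unfolding h_def using m p_pos a_pos by (intro sum_strict_mono) auto

lemma deriv: "t0 < t \<Longrightarrow> (x has_real_derivative \<beta> t * (F t - \<delta> * x t)) (at t)"
  using sol[of t] at_within_interior[of t "{t0..}"] unfolding F_def by simp

lemma continuous: "continuous_on {t0..} x"
  using sol by (auto simp: continuous_on_eq_continuous_within intro: DERIV_continuous)

lemma F_nonneg:
  assumes "t0 \<le> t" "\<And>s. t - r \<le> s \<Longrightarrow> s \<le> t \<Longrightarrow> 0 \<le> x s"
  shows "0 \<le> F t"
  unfolding F_def using assms p_pos \<tau>
  by (intro sum_nonneg mult_nonneg_nonneg) (auto simp: less_imp_le)

text \<open>As long as the past is nonnegative, births only help, and \<open>x\<close> stays above
  an exponential that decays faster than the largest death rate \<open>\<delta> * B\<close>.\<close>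

lemma positive:
  assumes "t0 \<le> t"
  shows "0 < x t"
proof -
  \<comment> \<open>The factor one half makes the initial comparison strict, and the
    \<open>+ 1\<close> in the rate makes the derivative of \<open>z - x\<close> at most
    \<open>- z u\<close> at a contact point \<open>u\<close>.\<close>
  define z where "z = (\<lambda>t. x t0 / 2 * exp (- (\<delta> * B + 1) * (t - t0)))"
  have z_pos: "0 < z t" for t using init_pos by (simp add: z_def)
  have "z t - x t < 0"
  proof (rule first_crossing[of t0 "\<lambda>t. z t - x t"
        "\<lambda>t. - (\<delta> * B + 1) * z t - \<beta> t * (F t - \<delta> * x t)"])
    show "continuous_on {t0..} (\<lambda>t. z t - x t)"
      unfolding z_def by (intro continuous_intros continuous)
    show "((\<lambda>t. z t - x t) has_real_derivative
        - (\<delta> * B + 1) * z t - \<beta> t * (F t - \<delta> * x t)) (at t)" if "t0 < t" for t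
      unfolding z_def
      by (rule derivative_eq_intros deriv[OF that] refl | simp add: field_simps)+
    show "z t0 - x t0 < 0" using init_pos by (simp add: z_def)
    fix u assume u: "t0 < u" "z u - x u = 0"
      and less: "\<And>s. t0 \<le> s \<Longrightarrow> s < u \<Longrightarrow> z s - x s < 0"
    have "0 \<le> x s" if "u - r \<le> s" "s \<le> u" for s
    proof (cases "s < t0")
      case True then show ?thesis using init_nonneg[of s] that u by simp
    next
      case False then show ?thesis using less[of s] z_pos[of s] that u by (cases "s = u") auto
    qed
    then have "0 \<le> \<beta> u * F u" using F_nonneg[of u] u \<beta>_pos[of u] by simp
    moreover have "\<beta> u * (\<delta> * x u) \<le> B * (\<delta> * x u)"
      using \<beta>(2)[of u] u z_pos[of u] \<delta>_pos by (intro mult_right_mono) auto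
    moreover have "z u = x u" using u by simp
    ultimately show "- (\<delta> * B + 1) * z u - \<beta> u * (F u - \<delta> * x u) < 0"
      using z_pos[of u] by (simp add: algebra_simps)
  qed fact
  then show ?thesis using z_pos[of t] by simp
qed

lemma nonneg: "t0 - r \<le> t \<Longrightarrow> 0 \<le> x t"
  using positive[of t] init_nonneg[of t] by (cases "t < t0") auto

section \<open>Decay and growth over one delay\<close>

text \<open>Nonnegativity of \<open>F\<close> gives \<open>x' \<ge> - \<delta> * B * x\<close>, so
  \<open>x\<close> times the integrating factor is nondecreasing.\<close>

lemma decay:
  assumes "t0 < s" "s \<le> t"
  shows "x s \<le> x t * exp (\<delta> * B * (t - s))"
proof -
  have "x s * exp (\<delta> * B * (s - s)) \<le> x t * exp (\<delta> * B * (t - s))"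
  proof (rule DERIV_nonneg_imp_nondecreasing[OF \<open>s \<le> t\<close>])
    fix u assume u: "s \<le> u" "u \<le> t"
    then have "t0 < u" using assms by simp
    have "((\<lambda>u. x u * exp (\<delta> * B * (u - s))) has_real_derivative
        (\<beta> u * F u + (B - \<beta> u) * (\<delta> * x u)) * exp (\<delta> * B * (u - s))) (at u)"
      by (rule derivative_eq_intros deriv[OF \<open>t0 < u\<close>] refl | simp add: algebra_simps)+
    moreover have "0 \<le> (\<beta> u * F u + (B - \<beta> u) * (\<delta> * x u)) * exp (\<delta> * B * (u - s))"
      using F_nonneg[of u] nonneg \<beta>_pos[of u] \<beta>(2)[of u] \<open>t0 < u\<close> positive[of u] \<delta>_pos
      by (intro mult_nonneg_nonneg add_nonneg_nonneg) auto
    ultimately show "\<exists>d. ((\<lambda>u. x u * exp (\<delta> * B * (u - s))) has_real_derivative d) (at u) \<and> 0 \<le> d"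
      by blast
  qed
  then show ?thesis by simp
qed

lemma decay_window:
  assumes "t0 < s" "s \<le> t" "t \<le> s + r"
  shows "x s \<le> x t * exp (\<delta> * B * r)"
proof -
  have "x t * exp (\<delta> * B * (t - s)) \<le> x t * exp (\<delta> * B * r)"
    using assms positive[of t] \<delta>_pos B_pos by (intro mult_left_mono) auto
  then show ?thesis using decay[OF assms(1,2)] by simp
qed

text \<open>
  The maximum over the past grows at rate at most \<open>P * B\<close>, and at time \<open>s\<close> it exceeds
  \<open>x s\<close> by at most the factor that bounds the decay over one delay.
\<close>

lemma growth_window:
  assumes "t0 + r < s" "s \<le> t" "t \<le> s + r" "x s < k"
  shows "x t < k * exp ((\<delta> + P) * B * r)"
proof -
  \<comment> \<open>Reading \<open>decay_window\<close> backwards from \<open>x s < k\<close> bounds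
    the whole window before \<open>s\<close> by \<open>k'\<close>; it lies beyond \<open>t0\<close>
    because \<open>t0 + r < s\<close>.\<close>
  define k' where "k' = k * exp (\<delta> * B * r)"
  have "0 < k" using assms positive[of s] r_nonneg by simp
  then have "0 < k'" by (simp add: k'_def)
  \<comment> \<open>A barrier starting at \<open>k'\<close> and growing at the largest birth rate
    \<open>P * B\<close>. As it is nondecreasing, at a first contact \<open>u\<close> the value
    \<open>z u\<close> dominates the delayed values before \<open>s\<close> as well as those
    after.\<close>
  define z where "z = (\<lambda>u. k' * exp (P * B * (u - s)))"
  have past: "x v < k'" if "s - r \<le> v" "v \<le> s" for v
  proof -
    have "x v \<le> x s * exp (\<delta> * B * r)" using decay_window[of v s] that assms by simp
    also have "\<dots> < k'" using assms by (simp add: k'_def)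
    finally show ?thesis .
  qed
  have less: "x t - z t < 0"
  proof (rule first_crossing[of s "\<lambda>t. x t - z t"
        "\<lambda>t. \<beta> t * (F t - \<delta> * x t) - P * B * z t"])
    show "continuous_on {s..} (\<lambda>t. x t - z t)"
      unfolding z_def using assms r_nonneg
      by (intro continuous_intros continuous_on_subset[OF continuous]) auto
    show "((\<lambda>t. x t - z t) has_real_derivative \<beta> t * (F t - \<delta> * x t) - P * B * z t) (at t)"
      if "s < t" for t
    proof -
      have "t0 < t" using that assms r_nonneg by simp
      then show ?thesis unfolding z_def
        by - (rule derivative_eq_intros deriv refl | assumption | simp add: field_simps)+
    qed
    show "x s - z s < 0" using past[of s] r_nonneg by (simp add: z_def)
    fix u assume u: "s < u" "x u - z u = 0"
      and less: "\<And>v. s \<le> v \<Longrightarrow> v < u \<Longrightarrow> x v - z v < 0"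
    have "t0 < u" using u assms r_nonneg by simp
    have mono: "z v \<le> z u" if "v \<le> u" for v
      unfolding z_def using that \<open>0 < k'\<close> P_pos B_pos by simp
    have dom: "x v \<le> z u" if "u - r \<le> v" "v \<le> u" for v
    proof (cases "v \<le> s")
      case True
      then have "x v \<le> z s" using past[of v] that u by (simp add: z_def)
      then show ?thesis using mono[of s] u by simp
    next
      case False
      then show ?thesis using less[of v] mono[of v] that u by (cases "v = u") auto
    qed
    have "F u \<le> (\<Sum>j=1..m. p j * z u * 1)"
      unfolding F_def
    proof (rule sum_mono)
      fix j assume j: "j \<in> {1..m}"
      have "0 \<le> x (u - \<tau> j u)" "0 \<le> x (u - \<sigma> j u)" "x (u - \<tau> j u) \<le> z u"
        using \<tau>[OF j, of u] \<sigma>[OF j, of u] \<open>t0 < u\<close> by (auto intro!: nonneg dom)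
      then show "p j * x (u - \<tau> j u) * exp (- a j * x (u - \<sigma> j u)) \<le> p j * z u * 1"
        using p_pos[OF j] a_pos[OF j] by (intro mult_mono) auto
    qed
    also have "\<dots> = P * z u" by (simp add: P_def sum_distrib_right)
    finally have "F u \<le> P * z u" .
    \<comment> \<open>The death term, positive by \<open>positive\<close>, gives the strict
      inequality that the crossing argument asks for.\<close>
    then have "\<beta> u * (F u - \<delta> * x u) < \<beta> u * (P * z u)"
      using \<beta>_pos[of u] positive[of u] \<delta>_pos \<open>t0 < u\<close>
      by (intro mult_strict_left_mono) (auto intro: less_le_trans[of _ "F u"])
    also have "\<dots> \<le> B * (P * z u)"
      using \<beta>(2)[of u] \<open>t0 < u\<close> P_pos \<open>0 < k'\<close> by (intro mult_right_mono) (auto simp: z_def)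
    finally show "\<beta> u * (F u - \<delta> * x u) - P * B * z u < 0" by (simp add: mult_ac)
  qed fact
  have "z t \<le> k' * exp (P * B * r)"
    unfolding z_def using \<open>0 < k'\<close> P_pos B_pos assms by simp
  with less have "x t < k' * exp (P * B * r)" by simp
  then show ?thesis by (simp add: k'_def algebra_simps exp_add)
qed

section \<open>Asymptotic bounds for the solution\<close>

lemma ln_deriv:
  "t0 < t \<Longrightarrow> ((\<lambda>t. ln (x t)) has_real_derivative \<beta> t * (F t / x t - \<delta>)) (at t)"
  using positive[of t] deriv[of t] by (auto intro!: derivative_eq_intros simp: field_simps)

text \<open>The Razumikhin criterion is applied to \<open>ln x\<close> with threshold
  \<open>C\<close>, the logarithm of the claimed bound. For \<open>l > C\<close> the gap
  \<open>l - C\<close> is shared between raising \<open>K\<close> to some \<open>k\<close> with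
  \<open>h k < \<delta>\<close> and the tolerance \<open>\<epsilon>\<close>.\<close>

lemma eventually_less:
  assumes "K * exp ((\<delta> + P) * B * r) < c"
  shows "\<forall>\<^sub>F t in at_top. x t < c"
proof -
  define C where "C = ln K + (\<delta> + P) * B * r"
  \<comment> \<open>Windows ending at or after \<open>T + r\<close> start beyond
    \<open>t0 + r\<close>, as \<open>growth_window\<close> requires.\<close>
  define T where "T = t0 + r + 1"
  have "exp C < c" using assms K_pos by (simp add: C_def exp_add)
  then have "0 < c" by (meson exp_gt_zero less_trans)
  then have "C < ln c" using ln_less_cancel_iff[of "exp C" c] \<open>exp C < c\<close> by simp
  have "\<forall>\<^sub>F t in at_top. ln (x t) < ln c"
  proof (rule razumikhin_eventually_less[OF _ r_nonneg _ \<open>C < ln c\<close>])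
    show "((\<lambda>t. ln (x t)) has_real_derivative \<beta> t * (F t / x t - \<delta>)) (at t)" if "T \<le> t" for t
      using ln_deriv[of t] that r_nonneg by (simp add: T_def)
    fix l assume "C < l"
    define k where "k = K * exp ((l - C) / 2)"
    have "K < k" using K_pos \<open>C < l\<close> by (simp add: k_def)
    then have "h k < \<delta>" using h_strict_anti[of K k] K_eq by (simp add: h_def)
    have "h k > 0" unfolding h_def using m p_pos by (intro sum_pos) auto
    \<comment> \<open>The first entry makes a window value below \<open>k\<close> incompatible with
      \<open>ln (x t) \<ge> l - \<epsilon>\<close>; the second gives
      \<open>exp (2 * \<epsilon>) * h k < \<delta>\<close>, where \<open>2 * \<epsilon>\<close> is
      the possible spread between \<open>ln (x t)\<close> and the window.\<close>
    define \<epsilon> where "\<epsilon> = min ((l - C) / 2) (ln (\<delta> / h k) / 4)"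
    have "ln (\<delta> / h k) > 0" using \<open>h k < \<delta>\<close> \<open>h k > 0\<close> by simp
    then have "\<epsilon> > 0" using \<open>C < l\<close> by (simp add: \<epsilon>_def)
    have "2 * \<epsilon> < ln (\<delta> / h k)" using \<open>ln (\<delta> / h k) > 0\<close> by (auto simp: \<epsilon>_def min_def)
    then have "exp (2 * \<epsilon>) < exp (ln (\<delta> / h k))" by simp
    then have small: "exp (2 * \<epsilon>) * h k < \<delta>" using \<open>h k > 0\<close> \<delta>_pos by (simp add: field_simps)
    define \<kappa> where "\<kappa> = b * (\<delta> - exp (2 * \<epsilon>) * h k)"
    have "\<kappa> > 0" using small b_pos by (simp add: \<kappa>_def)
    have "\<beta> t * (F t / x t - \<delta>) \<le> - \<kappa>"
      if t: "T + r \<le> t" "l - \<epsilon> \<le> ln (x t)" "\<forall>s\<in>{t - r..t}. ln (x s) \<le> l + \<epsilon>" for t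
    proof -
      have "t0 < t" using t r_nonneg by (simp add: T_def)
      then have "x t > 0" using positive[of t] by simp
      have window: "k \<le> x s" if s: "s \<in> {t - r..t}" for s
      proof (rule ccontr)
        assume "\<not> k \<le> x s"
        then have "x t < k * exp ((\<delta> + P) * B * r)"
          using growth_window[of s t k] s t by (simp add: T_def)
        also have "\<dots> = exp (l - (l - C) / 2)"
        proof -
          have "k * exp ((\<delta> + P) * B * r) = exp (ln K + (l - C) / 2 + (\<delta> + P) * B * r)"
            using K_pos by (simp only: k_def exp_add exp_ln)
          also have "ln K + (l - C) / 2 + (\<delta> + P) * B * r = l - (l - C) / 2"
            by (simp add: C_def field_simps)
          finally show ?thesis .
        qed
        also have "\<dots> \<le> exp (l - \<epsilon>)"
        proof -
          have "\<epsilon> \<le> (l - C) / 2" unfolding \<epsilon>_def by (rule min.cobounded1)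
          then show ?thesis by simp
        qed
        also have "\<dots> \<le> x t" using t \<open>x t > 0\<close> by (simp add: ln_ge_iff)
        finally show False by simp
      qed
      have ratio: "x s \<le> exp (2 * \<epsilon>) * x t" if s: "s \<in> {t - r..t}" for s
      proof -
        have "x s > 0" using s t r_nonneg by (intro positive) (auto simp: T_def)
        then have "x s = exp (ln (x s))" by simp
        also have "\<dots> \<le> exp (2 * \<epsilon> + ln (x t))" using t s by force
        also have "\<dots> = exp (2 * \<epsilon>) * x t" using \<open>x t > 0\<close> by (simp add: exp_add)
        finally show ?thesis .
      qed
      \<comment> \<open>\<open>ratio\<close> bounds the factors delayed by \<open>\<tau>\<close>,
        and \<open>window\<close> bounds the exponentials delayed by
        \<open>\<sigma>\<close>.\<close>
      have "F t \<le> (\<Sum>j=1..m. p j * (exp (2 * \<epsilon>) * x t) * exp (- a j * k))"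
        unfolding F_def
      proof (rule sum_mono)
        fix j assume j: "j \<in> {1..m}"
        have "x (t - \<tau> j t) \<le> exp (2 * \<epsilon>) * x t" "k \<le> x (t - \<sigma> j t)" "0 \<le> x (t - \<tau> j t)"
          using \<tau>[OF j, of t] \<sigma>[OF j, of t] \<open>t0 < t\<close> by (auto intro!: ratio window nonneg)
        then show "p j * x (t - \<tau> j t) * exp (- a j * x (t - \<sigma> j t))
            \<le> p j * (exp (2 * \<epsilon>) * x t) * exp (- a j * k)"
          using p_pos[OF j] a_pos[OF j] \<open>x t > 0\<close> by (intro mult_mono) auto
      qed
      also have "\<dots> = exp (2 * \<epsilon>) * h k * x t"
        by (simp add: h_def sum_distrib_left sum_distrib_right mult_ac)
      finally have "F t / x t \<le> exp (2 * \<epsilon>) * h k" using \<open>x t > 0\<close> by (simp add: field_simps)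
      then have "\<beta> t * (F t / x t - \<delta>) \<le> \<beta> t * (exp (2 * \<epsilon>) * h k - \<delta>)"
        using \<beta>_pos[of t] \<open>t0 < t\<close> by simp
      \<comment> \<open>The bracket is negative, so the lower bound \<open>b\<close> of the
        coefficient gives an upper estimate.\<close>
      also have "\<dots> \<le> b * (exp (2 * \<epsilon>) * h k - \<delta>)"
        using small \<beta>(1)[of t] \<open>t0 < t\<close> by (intro mult_right_mono_neg) auto
      finally show ?thesis by (simp add: \<kappa>_def algebra_simps)
    qed
    then show "\<exists>\<epsilon>>0. \<exists>\<kappa>>0. \<forall>t\<ge>T + r. l - \<epsilon> \<le> ln (x t) \<longrightarrow>
        (\<forall>s\<in>{t - r..t}. ln (x s) \<le> l + \<epsilon>) \<longrightarrow> \<beta> t * (F t / x t - \<delta>) \<le> - \<kappa>"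
      using \<open>\<epsilon> > 0\<close> \<open>\<kappa> > 0\<close> by blast
  qed
  then show ?thesis
    using eventually_ge_at_top[of t0]
    by eventually_elim (use positive \<open>0 < c\<close> in simp)
qed

text \<open>The mirror argument for \<open>- ln x\<close>; nonpositive \<open>c\<close> is settled
  by positivity. Only the death rate enters the exponent, because the possible loss within one delay
  is given by \<open>decay_window\<close>.\<close>

lemma eventually_greater:
  assumes "c < K * exp (- \<delta> * B * r)"
  shows "\<forall>\<^sub>F t in at_top. c < x t"
proof (cases "c > 0")
  case False
  then show ?thesis
    using positive by (auto simp: eventually_at_top_linorder intro!: exI[of _ t0])
      (meson not_less less_le_trans le_less_trans)
next
  case True
  define C where "C = - ln K + \<delta> * B * r"
  \<comment> \<open>Here windows need only start beyond \<open>t0\<close>, the requirement of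
    \<open>decay_window\<close>.\<close>
  define T where "T = t0 + 1"
  have "c < exp (- C)" using assms K_pos by (simp add: C_def exp_diff exp_minus field_simps)
  then have "C < - ln c" using True ln_less_cancel_iff[of c "exp (- C)"] by simp
  have "\<forall>\<^sub>F t in at_top. - ln (x t) < - ln c"
  proof (rule razumikhin_eventually_less[OF _ r_nonneg _ \<open>C < - ln c\<close>])
    show "((\<lambda>t. - ln (x t)) has_real_derivative \<beta> t * (\<delta> - F t / x t)) (at t)" if "T \<le> t" for t
      using DERIV_minus[OF ln_deriv[of t]] that r_nonneg by (simp add: T_def algebra_simps)
    fix l assume "C < l"
    define k where "k = K * exp (- (l - C) / 2)"
    have "k < K" using K_pos \<open>C < l\<close> by (simp add: k_def)
    then have "h k > \<delta>" using h_strict_anti[of k K] K_eq by (simp add: h_def)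
    \<comment> \<open>The first entry puts \<open>exp (\<epsilon> - l)\<close> strictly below
      \<open>exp ((l - C) / 2 - l)\<close> in the window estimate; the second keeps the per capita
      birth rate above \<open>\<delta>\<close> despite the loss factor
      \<open>exp (- 2 * \<epsilon>)\<close>.\<close>
    define \<epsilon> where "\<epsilon> = min ((l - C) / 4) (ln (h k / \<delta>) / 4)"
    have "ln (h k / \<delta>) > 0" using \<open>h k > \<delta>\<close> \<delta>_pos by simp
    then have "\<epsilon> > 0" using \<open>C < l\<close> by (simp add: \<epsilon>_def)
    have "2 * \<epsilon> < ln (h k / \<delta>)" using \<open>ln (h k / \<delta>) > 0\<close> by (auto simp: \<epsilon>_def min_def)
    then have "exp (2 * \<epsilon>) < exp (ln (h k / \<delta>))" by simp
    then have small: "\<delta> < exp (- 2 * \<epsilon>) * h k"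
      using \<open>h k > \<delta>\<close> \<delta>_pos by (simp add: field_simps exp_minus)
    define \<kappa> where "\<kappa> = b * (exp (- 2 * \<epsilon>) * h k - \<delta>)"
    have "\<kappa> > 0" using small b_pos by (simp add: \<kappa>_def)
    have "\<beta> t * (\<delta> - F t / x t) \<le> - \<kappa>"
      if t: "T + r \<le> t" "l - \<epsilon> \<le> - ln (x t)" "\<forall>s\<in>{t - r..t}. - ln (x s) \<le> l + \<epsilon>" for t
    proof -
      have "t0 < t" using t r_nonneg by (simp add: T_def)
      then have "x t > 0" using positive[of t] by simp
      have window: "x s \<le> k" if s: "s \<in> {t - r..t}" for s
      proof (rule ccontr)
        assume "\<not> x s \<le> k"
        have "x t = exp (ln (x t))" using \<open>x t > 0\<close> by simp
        also have "\<dots> \<le> exp (\<epsilon> - l)" using t by simp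
        also have "\<dots> < exp ((l - C) / 2 - l)" using \<open>C < l\<close> by (simp add: \<epsilon>_def min_def)
        also have "\<dots> = k * exp (- (\<delta> * B * r))"
        proof -
          have "k * exp (- (\<delta> * B * r)) = exp (ln K + - (l - C) / 2 + - (\<delta> * B * r))"
            using K_pos by (simp only: k_def exp_add exp_ln)
          also have "ln K + - (l - C) / 2 + - (\<delta> * B * r) = (l - C) / 2 - l"
            by (simp add: C_def field_simps)
          finally show ?thesis by simp
        qed
        finally have "x t * exp (\<delta> * B * r) < k" by (simp add: exp_minus field_simps)
        moreover have "x s \<le> x t * exp (\<delta> * B * r)"
          using s t by (intro decay_window) (auto simp: T_def)
        ultimately show False using \<open>\<not> x s \<le> k\<close> by simp
      qed
      have ratio: "exp (- 2 * \<epsilon>) * x t \<le> x s" if s: "s \<in> {t - r..t}" for s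
      proof -
        have "x s > 0" using s t r_nonneg by (intro positive) (auto simp: T_def)
        have "exp (- 2 * \<epsilon>) * x t = exp (- 2 * \<epsilon> + ln (x t))"
          using \<open>x t > 0\<close> by (simp only: exp_add exp_ln)
        also have "\<dots> \<le> exp (ln (x s))" using t s by force
        also have "\<dots> = x s" using \<open>x s > 0\<close> by simp
        finally show ?thesis .
      qed
      have "exp (- 2 * \<epsilon>) * h k * x t
          = (\<Sum>j=1..m. p j * (exp (- 2 * \<epsilon>) * x t) * exp (- a j * k))"
        by (simp add: h_def sum_distrib_left sum_distrib_right mult_ac)
      also have "\<dots> \<le> F t"
        unfolding F_def
      proof (rule sum_mono)
        fix j assume j: "j \<in> {1..m}"
        have "exp (- 2 * \<epsilon>) * x t \<le> x (t - \<tau> j t)" "x (t - \<sigma> j t) \<le> k" "0 \<le> x (t - \<tau> j t)"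
          using \<tau>[OF j, of t] \<sigma>[OF j, of t] \<open>t0 < t\<close>
            ratio[of "t - \<tau> j t"] window[of "t - \<sigma> j t"] by (auto intro!: nonneg)
        then show "p j * (exp (- 2 * \<epsilon>) * x t) * exp (- a j * k)
            \<le> p j * x (t - \<tau> j t) * exp (- a j * x (t - \<sigma> j t))"
          using p_pos[OF j] a_pos[OF j] \<open>x t > 0\<close> by (intro mult_mono) auto
      qed
      finally have "exp (- 2 * \<epsilon>) * h k \<le> F t / x t" using \<open>x t > 0\<close> by (simp add: field_simps)
      then have "\<beta> t * (\<delta> - F t / x t) \<le> \<beta> t * (\<delta> - exp (- 2 * \<epsilon>) * h k)"
        using \<beta>_pos[of t] \<open>t0 < t\<close> by simp
      also have "\<dots> \<le> b * (\<delta> - exp (- 2 * \<epsilon>) * h k)"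
        using small \<beta>(1)[of t] \<open>t0 < t\<close> by (intro mult_right_mono_neg) auto
      finally show ?thesis by (simp add: \<kappa>_def algebra_simps)
    qed
    then show "\<exists>\<epsilon>>0. \<exists>\<kappa>>0. \<forall>t\<ge>T + r. l - \<epsilon> \<le> - ln (x t) \<longrightarrow>
        (\<forall>s\<in>{t - r..t}. - ln (x s) \<le> l + \<epsilon>) \<longrightarrow> \<beta> t * (\<delta> - F t / x t) \<le> - \<kappa>"
      using \<open>\<epsilon> > 0\<close> \<open>\<kappa> > 0\<close> by blast
  qed
  then show ?thesis
    using eventually_ge_at_top[of t0]
    by eventually_elim (use positive True in simp)
qed

section \<open>Passage to limit superior and limit inferior\<close>

lemma Limsup_le: "Limsup at_top (\<lambda>t. ereal (x t)) \<le> ereal (K * exp ((\<delta> + P) * B * r))"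
  unfolding Limsup_le_iff
proof safe
  fix y :: ereal assume "ereal (K * exp ((\<delta> + P) * B * r)) < y"
  \<comment> \<open>The level \<open>y\<close> may be infinite, so a real \<open>c\<close> is placed
    strictly between the bound and \<open>y\<close>.\<close>
  then obtain c where c: "K * exp ((\<delta> + P) * B * r) < c" "ereal c < y"
    using ereal_dense2 by (metis less_ereal.simps(1))
  from eventually_less[OF c(1)] show "\<forall>\<^sub>F t in at_top. ereal (x t) < y"
    by eventually_elim (use c(2) in \<open>auto intro: less_trans[of _ "ereal c"]\<close>)
qed

lemma Liminf_ge: "ereal (K * exp (- \<delta> * B * r)) \<le> Liminf at_top (\<lambda>t. ereal (x t))"
  unfolding le_Liminf_iff
proof safe
  fix y :: ereal assume "y < ereal (K * exp (- \<delta> * B * r))"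
  then obtain c where c: "c < K * exp (- \<delta> * B * r)" "y < ereal c"
    using ereal_dense2 by (metis less_ereal.simps(1))
  from eventually_greater[OF c(1)] show "\<forall>\<^sub>F t in at_top. y < ereal (x t)"
    by eventually_elim (use c(2) in \<open>auto intro: less_trans[of _ "ereal c"]\<close>)
qed

end

section \<open>Permanence and the bounds for all solutions\<close>

theorem theorem2p1:
  fixes t0 \<delta> :: real and m :: nat
    and p a :: "nat \<Rightarrow> real"
    and \<beta> :: "real \<Rightarrow> real"
    and \<tau> \<sigma> :: "nat \<Rightarrow> real \<Rightarrow> real"
  assumes "1 \<le> m"
    and "\<And>j. j \<in> {1..m} \<Longrightarrow> 0 < p j"
    and "\<And>j. j \<in> {1..m} \<Longrightarrow> 0 < a j"
    and "0 < \<delta>"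
    and "continuous_on {t0..} \<beta>" "bounded (\<beta> ` {t0..})"
    and "0 < (INF t\<in>{t0..}. \<beta> t)"
    and "\<And>j. j \<in> {1..m} \<Longrightarrow> continuous_on {t0..} (\<tau> j)"
    and "\<And>j. j \<in> {1..m} \<Longrightarrow> bounded (\<tau> j ` {t0..})"
    and "\<And>j t. j \<in> {1..m} \<Longrightarrow> t0 \<le> t \<Longrightarrow> 0 \<le> \<tau> j t"
    and "\<And>j. j \<in> {1..m} \<Longrightarrow> continuous_on {t0..} (\<sigma> j)"
    and "\<And>j. j \<in> {1..m} \<Longrightarrow> bounded (\<sigma> j ` {t0..})"
    and "\<And>j t. j \<in> {1..m} \<Longrightarrow> t0 \<le> t \<Longrightarrow> 0 \<le> \<sigma> j t"
    and "\<delta> < (\<Sum>j=1..m. p j)"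
  shows "nicholson_permanent t0 m p a \<delta> \<beta> \<tau> \<sigma> \<and>
    (let K = positive_equilibrium m p a \<delta>;
         r = max_delay t0 m \<tau> \<sigma>;
         \<beta>' = (SUP t\<in>{t0..}. \<beta> t);
         P = (\<Sum>j=1..m. p j)
     in \<forall>\<phi>\<in>admissible_histories r. \<forall>x. nicholson_solution t0 m p a \<delta> \<beta> \<tau> \<sigma> \<phi> x \<longrightarrow>
          ereal (K * exp (- 2 * \<delta> * \<beta>' * r)) \<le> Liminf at_top (\<lambda>t. ereal (x t)) \<and>
          Liminf at_top (\<lambda>t. ereal (x t)) \<le> Limsup at_top (\<lambda>t. ereal (x t)) \<and>
          Limsup at_top (\<lambda>t. ereal (x t)) \<le> ereal (K * exp (2 * (\<delta> + P) * \<beta>' * r)))"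
proof -
  define K where "K = positive_equilibrium m p a \<delta>"
  define r where "r = max_delay t0 m \<tau> \<sigma>"
  define b where "b = (INF t\<in>{t0..}. \<beta> t)"
  define B where "B = (SUP t\<in>{t0..}. \<beta> t)"
  define P where "P = (\<Sum>j=1..m. p j)"
  have K: "0 < K" "(\<Sum>j=1..m. p j * exp (- a j * K)) = \<delta>"
    using theI'[OF positive_equilibrium_unique[of m p a \<delta>]] assms(2,3,4,14)
    unfolding K_def positive_equilibrium_def by blast+
  have upper: "f t \<le> (SUP t\<in>{t0..}. f t)" if "bounded (f ` {t0..})" "t0 \<le> t"
    for f :: "real \<Rightarrow> real" and t
    using that by (intro cSUP_upper bounded_imp_bdd_above) auto
  have lower: "b \<le> \<beta> t" if "t0 \<le> t" for t
    unfolding b_def using that assms(6) by (intro cINF_lower bounded_imp_bdd_below) auto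
  have \<tau>_le: "\<tau> j t \<le> r" if "j \<in> {1..m}" "t0 \<le> t" for j t
  proof -
    have "(SUP t\<in>{t0..}. \<tau> j t) \<le> r"
      unfolding r_def max_delay_def using that by (intro Max_ge) auto
    then show ?thesis using upper[OF assms(9)] that by (meson order_trans)
  qed
  have \<sigma>_le: "\<sigma> j t \<le> r" if "j \<in> {1..m}" "t0 \<le> t" for j t
  proof -
    have "(SUP t\<in>{t0..}. \<sigma> j t) \<le> r"
      unfolding r_def max_delay_def using that by (intro Max_ge) auto
    then show ?thesis using upper[OF assms(12)] that by (meson order_trans)
  qed
  have "0 < b" using assms(7) by (simp add: b_def)
  have nich: "nicholson t0 r \<delta> b B m p a \<beta> \<tau> \<sigma> x K"
    if \<phi>: "\<phi> \<in> admissible_histories r" and x: "nicholson_solution t0 m p a \<delta> \<beta> \<tau> \<sigma> \<phi> x"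
    for \<phi> x
  proof -
    \<comment> \<open>This places \<open>t0\<close> itself in the history interval, so that
      \<open>0 < \<phi> 0\<close> becomes \<open>0 < x t0\<close>.\<close>
    have "0 \<le> r" using \<tau>_le[of 1 t0] assms(10)[of 1 t0] assms(1) by force
    have hist: "x t = \<phi> (t - t0)" if "t0 - r \<le> t" "t \<le> t0" for t
    proof -
      have "t - t0 \<in> {- r..0}" using that by simp
      then have "x (t0 + (t - t0)) = \<phi> (t - t0)"
        using x unfolding nicholson_solution_def r_def[symmetric] by blast
      then show ?thesis by simp
    qed
    show ?thesis
    proof
      show "0 \<le> x t" if "t0 - r \<le> t" "t < t0" for t
        using hist[of t] \<phi> that by (auto simp: admissible_histories_def)
      show "0 < x t0" using hist[of t0] \<phi> \<open>0 \<le> r\<close> by (simp add: admissible_histories_def)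
      show "(x has_real_derivative \<beta> t *
          ((\<Sum>j=1..m. p j * x (t - \<tau> j t) * exp (- a j * x (t - \<sigma> j t))) - \<delta> * x t))
          (at t within {t0..})" if "t0 \<le> t" for t
        using x that unfolding nicholson_solution_def by blast
      show "\<beta> t \<le> B" if "t0 \<le> t" for t using upper[OF assms(6) that] by (simp add: B_def)
    qed (use assms K \<open>0 < b\<close> lower \<tau>_le \<sigma>_le in auto)
  qed
  have P: "nicholson.P m p = P" if "nicholson t0 r \<delta> b B m p a \<beta> \<tau> \<sigma> x K" for x
    using nicholson.P_def[OF that] by (simp add: P_def)
  \<comment> \<open>The factor 2 gives strict room on either side of the asymptotic bounds. Both
    constants are independent of \<open>\<phi>\<close>, as permanence demands.\<close>
  define c1 where "c1 = K * exp (- \<delta> * B * r) / 2"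
  define c2 where "c2 = K * exp ((\<delta> + P) * B * r) * 2"
  have c: "0 < c1" "0 < c2" using K by (auto simp: c1_def c2_def)
  have "\<exists>t1\<ge>t0. \<forall>t\<ge>t1. c1 \<le> x t \<and> x t \<le> c2"
    if \<phi>: "\<phi> \<in> admissible_histories r" and x: "nicholson_solution t0 m p a \<delta> \<beta> \<tau> \<sigma> \<phi> x"
    for \<phi> x
  proof -
    interpret N: nicholson t0 r \<delta> b B m p a \<beta> \<tau> \<sigma> x K by (rule nich[OF \<phi> x])
    have "\<forall>\<^sub>F t in at_top. c1 < x t"
      by (rule N.eventually_greater) (use K in \<open>simp add: c1_def\<close>)
    moreover have "\<forall>\<^sub>F t in at_top. x t < c2"
      by (rule N.eventually_less) (use K P[OF nich[OF \<phi> x]] in \<open>simp add: c2_def\<close>)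
    ultimately have "\<forall>\<^sub>F t in at_top. c1 \<le> x t \<and> x t \<le> c2"
      by eventually_elim simp
    then obtain t1 where "\<forall>t\<ge>t1. c1 \<le> x t \<and> x t \<le> c2"
      unfolding eventually_at_top_linorder by blast
    then show ?thesis by (intro exI[of _ "max t0 t1"]) auto
  qed
  with c have "nicholson_permanent t0 m p a \<delta> \<beta> \<tau> \<sigma>"
    unfolding nicholson_permanent_def r_def[symmetric] by blast
  moreover have "ereal (K * exp (- 2 * \<delta> * B * r)) \<le> Liminf at_top (\<lambda>t. ereal (x t)) \<and>
      Liminf at_top (\<lambda>t. ereal (x t)) \<le> Limsup at_top (\<lambda>t. ereal (x t)) \<and>
      Limsup at_top (\<lambda>t. ereal (x t)) \<le> ereal (K * exp (2 * (\<delta> + P) * B * r))"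
    if \<phi>: "\<phi> \<in> admissible_histories r" and x: "nicholson_solution t0 m p a \<delta> \<beta> \<tau> \<sigma> \<phi> x"
    for \<phi> x
  proof (intro conjI)
    interpret N: nicholson t0 r \<delta> b B m p a \<beta> \<tau> \<sigma> x K by (rule nich[OF \<phi> x])
    have "0 < P" using N.P_pos P[OF nich[OF \<phi> x]] by simp
    then have "0 \<le> \<delta> * B * r" "0 \<le> (\<delta> + P) * B * r"
      using N.\<delta>_pos N.B_pos N.r_nonneg by simp_all
    \<comment> \<open>Since both exponents have a definite sign, doubling them only weakens the
      bounds.\<close>
    then have "ereal (K * exp (- 2 * \<delta> * B * r)) \<le> ereal (K * exp (- \<delta> * B * r))"
      "ereal (K * exp ((\<delta> + P) * B * r)) \<le> ereal (K * exp (2 * (\<delta> + P) * B * r))"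
      using N.K_pos by (auto simp: algebra_simps)
    then show "ereal (K * exp (- 2 * \<delta> * B * r)) \<le> Liminf at_top (\<lambda>t. ereal (x t))"
      "Limsup at_top (\<lambda>t. ereal (x t)) \<le> ereal (K * exp (2 * (\<delta> + P) * B * r))"
      using N.Liminf_ge N.Limsup_le unfolding P[OF nich[OF \<phi> x]] by (blast intro: order_trans)+
    show "Liminf at_top (\<lambda>t. ereal (x t)) \<le> Limsup at_top (\<lambda>t. ereal (x t))"
      by (simp add: Liminf_le_Limsup)
  qed
  ultimately show ?thesis
    unfolding Let_def K_def[symmetric] r_def[symmetric] B_def[symmetric] P_def[symmetric] by blast
qed

end
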